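(* Let $\mathcal A$ be an almost-$\Gamma$-like collection of sets and $\mathcal B$ a $\Gamma$-like collection of sets. Then the following are equivalent: (1) $\alpha_4(\mathcal A,\mathcal B)$ holds; (2) Player I does not have a predetermined winning strategy in the game $G_{<2}(\mathcal A,\mathcal B)$; (3) Player I does not have a predetermined winning strategy in the game $G_{fin}(\mathcal A,\mathcal B)$.
   Context: A collection $\mathcal B$ of sets is $\Gamma$-like if every $B\in\mathcal B$ is infinite and every infinite subset of $B$ also belongs to $\mathcal B$. A collection $\mathcal A$ of sets is almost-$\Gamma$-like if for each $A\in\mathcal A$ there is $A'\subseteq A$ with $|A'|=\aleph_0$ such that every cofinite subset $A''$ of $A'$ belongs to $\mathcal A$. $\alpha_4(\mathcal A,\mathcal B)$ is the statement: whenever $A_n\in\mathcal A$ for all $n<\omega$, there exists $B\in\mathcal B$ such that $A_n\cap B$ is non-empty for infinitely many $n<\omega$. The game $G_{fin}(\mathcal A,\mathcal B)$ has length $\omega$: during round $n<\omega$, Player I chooses $A_n\in\mathcal A$, then Player II chooses a finite (possibly empty) subset $F_n\subseteq A_n$. Player II wins if $\bigcup\{F_n:n<\omega\}\in\mathcal B$, and Player I wins otherwise. The game $G_{<2}(\mathcal A,\mathcal B)$ is defined in the same way except that Player II must choose $F_n\subseteq A_n$ with $|F_n|<2$ (0 or 1 points). A strategy is predetermined if it relies only on the round number and ignores the opponent's moves (so for Player I it is a sequence $(A_n)_{n<\omega}$ of members of $\mathcal A$); it is winning if it defeats every possible counterplay by the opponent. *)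

theory Defs
  imports Main "HOL-Library.Countable_Set"
begin

definition Gamma_like :: "'a set set \<Rightarrow> bool" where
  "Gamma_like \<B> \<longleftrightarrow>
     (\<forall>B\<in>\<B>. infinite B \<and> (\<forall>C. C \<subseteq> B \<longrightarrow> infinite C \<longrightarrow> C \<in> \<B>))"

definition almost_Gamma_like :: "'a set set \<Rightarrow> bool" where
  "almost_Gamma_like \<A> \<longleftrightarrow>
     (\<forall>A\<in>\<A>. \<exists>A'\<subseteq>A. countable A' \<and> infinite A' \<and>
        (\<forall>A''. A'' \<subseteq> A' \<longrightarrow> finite (A' - A'') \<longrightarrow> A'' \<in> \<A>))"

definition alpha4 :: "'a set set \<Rightarrow> 'a set set \<Rightarrow> bool" where
  "alpha4 \<A> \<B> \<longleftrightarrow>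
     (\<forall>A :: nat \<Rightarrow> 'a set. (\<forall>n. A n \<in> \<A>) \<longrightarrow>
        (\<exists>B\<in>\<B>. infinite {n. A n \<inter> B \<noteq> {}}))"

text \<open>
  The selection games of length \<open>\<omega>\<close> are treated uniformly. The parameter \<open>small\<close> is the size
  restriction on the moves of Player II. A strategy for Player I maps the list of the previous
  moves of Player II to the next move of Player I. It is required to answer every list with a
  member of \<open>\<A>\<close>; its values on lists that do not arise in a legal play have no influence on
  the game.
\<close>

definition strategy_I :: "'a set set \<Rightarrow> ('a set list \<Rightarrow> 'a set) \<Rightarrow> bool" where
  "strategy_I \<A> \<sigma> \<longleftrightarrow> (\<forall>h. \<sigma> h \<in> \<A>)"

text \<open>The number of previous moves is the number of the current round.\<close>

definition predetermined :: "('a set list \<Rightarrow> 'a set) \<Rightarrow> bool" where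
  "predetermined \<sigma> \<longleftrightarrow> (\<forall>h h'. length h = length h' \<longrightarrow> \<sigma> h = \<sigma> h')"

definition counterplay_II ::
    "('a set \<Rightarrow> bool) \<Rightarrow> ('a set list \<Rightarrow> 'a set) \<Rightarrow> (nat \<Rightarrow> 'a set) \<Rightarrow> bool" where
  "counterplay_II small \<sigma> F \<longleftrightarrow> (\<forall>n. F n \<subseteq> \<sigma> (map F [0..<n]) \<and> small (F n))"

definition winning_I ::
    "('a set \<Rightarrow> bool) \<Rightarrow> 'a set set \<Rightarrow> ('a set list \<Rightarrow> 'a set) \<Rightarrow> bool" where
  "winning_I small \<B> \<sigma> \<longleftrightarrow> (\<forall>F. counterplay_II small \<sigma> F \<longrightarrow> (\<Union>n. F n) \<notin> \<B>)"

definition I_has_predetermined_winning_strategy ::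
    "('a set \<Rightarrow> bool) \<Rightarrow> 'a set set \<Rightarrow> 'a set set \<Rightarrow> bool" where
  "I_has_predetermined_winning_strategy small \<A> \<B> \<longleftrightarrow>
     (\<exists>\<sigma>. strategy_I \<A> \<sigma> \<and> predetermined \<sigma> \<and> winning_I small \<B> \<sigma>)"

definition I_pre_wins_G_fin :: "'a set set \<Rightarrow> 'a set set \<Rightarrow> bool" where
  "I_pre_wins_G_fin = I_has_predetermined_winning_strategy finite"

text \<open>Finiteness is stated explicitly because \<open>card\<close> is \<open>0\<close> on infinite sets.\<close>

definition I_pre_wins_G_less_2 :: "'a set set \<Rightarrow> 'a set set \<Rightarrow> bool" where
  "I_pre_wins_G_less_2 = I_has_predetermined_winning_strategy (\<lambda>F. finite F \<and> card F < 2)"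

end

theory Submission
  imports Defs
begin

text \<open>
  A predetermined strategy of Player I is a sequence of members of \<open>\<A>\<close>, so (2) and (3) say that
  from every such sequence one can select subsets of the permitted size whose union lies in
  \<open>\<B>\<close>. Then (2) implies (3) because at most one point is finitely many points, and (3) implies (1)
  because members of \<open>\<B>\<close> are infinite: a union of finite sets can be infinite only if infinitely
  many of them are non-empty.

  The implication from (1) to (2) is where almost-\<open>\<Gamma>\<close>-likeness enters. The set \<open>B\<close> given by
  \<open>\<alpha>\<^sub>4\<close> might meet all the sets \<open>A n\<close> in one and the same point, so that picking a point of
  \<open>A n \<inter> B\<close> for each possible \<open>n\<close> need not produce an infinite set. To prevent this, \<open>\<alpha>\<^sub>4\<close> is
  applied to smaller sets. Each \<open>A n\<close> is shrunk to a countable set all of whose cofinite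
  subsets are in \<open>\<A>\<close>; the union of these countable sets is enumerated, and its first \<open>n + 1\<close>
  elements are removed from the \<open>n\<close>-th one (\<open>point_finite_after_finite_removal\<close>). Now no point
  belongs to infinitely many of the sets, so the points selected for infinitely many \<open>n\<close> form an
  infinite subset of \<open>B\<close>, even if some are selected more than once. As \<open>\<B>\<close> is \<open>\<Gamma>\<close>-like, this
  subset is in \<open>\<B>\<close>.
\<close>

text \<open>
  A history enters a predetermined strategy only through its length, so strategies can be traded
  for sequences and the recursive dependence on past moves disappears from the game.
\<close>

lemma no_predetermined_winning_strategy_iff:
  "\<not> I_has_predetermined_winning_strategy small \<A> \<B> \<longleftrightarrow>
     (\<forall>A :: nat \<Rightarrow> 'a set. (\<forall>n. A n \<in> \<A>) \<longrightarrow>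
        (\<exists>F. (\<forall>n. F n \<subseteq> A n \<and> small (F n)) \<and> (\<Union>n. F n) \<in> \<B>))"
  (is "?no_strategy \<longleftrightarrow> ?selections")
proof
  assume no: ?no_strategy
  show ?selections
  proof (intro allI impI)
    fix A :: "nat \<Rightarrow> 'a set"
    assume A: "\<forall>n. A n \<in> \<A>"
    define \<sigma> :: "'a set list \<Rightarrow> 'a set" where "\<sigma> = (\<lambda>h. A (length h))"
    have "strategy_I \<A> \<sigma>" "predetermined \<sigma>"
      using A by (simp_all add: \<sigma>_def strategy_I_def predetermined_def)
    with no have "\<not> winning_I small \<B> \<sigma>"
      by (auto simp: I_has_predetermined_winning_strategy_def)
    then show "\<exists>F. (\<forall>n. F n \<subseteq> A n \<and> small (F n)) \<and> (\<Union>n. F n) \<in> \<B>"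
      by (auto simp: winning_I_def counterplay_II_def \<sigma>_def)
  qed
next
  assume sel: ?selections
  show ?no_strategy
  proof
    assume "I_has_predetermined_winning_strategy small \<A> \<B>"
    then obtain \<sigma> where \<sigma>: "strategy_I \<A> \<sigma>" "predetermined \<sigma>" "winning_I small \<B> \<sigma>"
      by (auto simp: I_has_predetermined_winning_strategy_def)
    define A where "A n = \<sigma> (replicate n {})" for n
    have "\<forall>n. A n \<in> \<A>"
      using \<sigma>(1) by (simp add: A_def strategy_I_def)
    with sel obtain F where F: "\<forall>n. F n \<subseteq> A n \<and> small (F n)" "(\<Union>n. F n) \<in> \<B>"
      by blast
    have "\<sigma> (map F [0..<n]) = A n" for n
      unfolding A_def by (rule \<sigma>(2)[unfolded predetermined_def, rule_format]) simp
    with F(1) have "counterplay_II small \<sigma> F"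
      by (simp add: counterplay_II_def)
    with \<sigma>(3) F(2) show False
      by (simp add: winning_I_def)
  qed
qed

lemma I_pre_wins_mono:
  assumes "I_has_predetermined_winning_strategy small' \<A> \<B>"
    and "\<And>F. small F \<Longrightarrow> small' F"
  shows "I_has_predetermined_winning_strategy small \<A> \<B>"
proof -
  have "counterplay_II small' \<sigma> F" if "counterplay_II small \<sigma> F" for \<sigma> F
    using that assms(2) by (simp add: counterplay_II_def)
  with assms(1) show ?thesis
    unfolding I_has_predetermined_winning_strategy_def winning_I_def by blast
qed

lemma alpha4_if_not_I_pre_wins_G_fin:
  assumes \<B>: "Gamma_like \<B>" and no: "\<not> I_pre_wins_G_fin \<A> \<B>"
  shows "alpha4 \<A> \<B>"
  unfolding alpha4_def
proof (intro allI impI)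
  fix A :: "nat \<Rightarrow> 'a set"
  assume "\<forall>n. A n \<in> \<A>"
  with no have "\<exists>F. (\<forall>n. F n \<subseteq> A n \<and> finite (F n)) \<and> (\<Union>n. F n) \<in> \<B>"
    unfolding I_pre_wins_G_fin_def no_predetermined_winning_strategy_iff by simp
  then obtain F where F: "\<And>n. F n \<subseteq> A n" "\<And>n. finite (F n)" and UF: "(\<Union>n. F n) \<in> \<B>"
    by metis
  let ?N = "{n. A n \<inter> (\<Union>n. F n) \<noteq> {}}"
  have "infinite ?N"
  proof
    assume fin: "finite ?N"
    have "(\<Union>n. F n) \<subseteq> (\<Union>n\<in>?N. F n)"
      using F(1) by fast
    moreover have "finite (\<Union>n\<in>?N. F n)"
      using fin F(2) by blast
    ultimately have "finite (\<Union>n. F n)"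
      by (rule finite_subset)
    with \<B> UF show False
      by (simp add: Gamma_like_def)
  qed
  with UF show "\<exists>B\<in>\<B>. infinite {n. A n \<inter> B \<noteq> {}}"
    by blast
qed

text \<open>
  Once the union is enumerated, removing its first \<open>n + 1\<close> elements from \<open>C n\<close> leaves the
  \<open>k\<close>-th element in no set of index \<open>k\<close> or larger.
\<close>

lemma point_finite_after_finite_removal:
  fixes C :: "nat \<Rightarrow> 'a set"
  assumes "\<And>n. countable (C n)"
  obtains G where "\<And>n. finite (G n)" and "\<And>x. finite {n. x \<in> C n - G n}"
proof
  let ?U = "\<Union>n. C n"
  define G where "G n = from_nat_into ?U ` {..n}" for n
  show "finite (G n)" for n
    by (simp add: G_def)
  show "finite {n. x \<in> C n - G n}" for x
  proof (cases "x \<in> ?U")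
    case True
    then obtain k where k: "from_nat_into ?U k = x"
      using from_nat_into_surj[of ?U x] assms by blast
    have "{n. x \<in> C n - G n} \<subseteq> {..<k}"
    proof
      fix n assume "n \<in> {n. x \<in> C n - G n}"
      then have "x \<notin> G n" by simp
      with k show "n \<in> {..<k}"
        unfolding G_def by (metis atMost_iff image_eqI lessThan_iff not_less)
    qed
    then show ?thesis
      by (rule finite_subset) simp
  next
    case False
    then have "{n. x \<in> C n - G n} = {}" by blast
    then show ?thesis by (simp only: finite.emptyI)
  qed
qed

text \<open>
  The device that keeps selected points from repeating too often: with at most finitely many
  repetitions of each point, infinitely many selections yield infinitely many points.
\<close>

lemma almost_Gamma_like_point_finite_refinement:
  fixes A :: "nat \<Rightarrow> 'a set"
  assumes \<A>: "almost_Gamma_like \<A>" and A: "\<And>n. A n \<in> \<A>"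
  obtains D where "\<And>n. D n \<in> \<A>" and "\<And>n. D n \<subseteq> A n" and "\<And>x. finite {n. x \<in> D n}"
proof -
  have "\<forall>n. \<exists>C\<subseteq>A n. countable C \<and> (\<forall>D. D \<subseteq> C \<longrightarrow> finite (C - D) \<longrightarrow> D \<in> \<A>)"
    using \<A> A unfolding almost_Gamma_like_def by meson
  then obtain C where C: "\<And>n. C n \<subseteq> A n" "\<And>n. countable (C n)"
      "\<And>n D. D \<subseteq> C n \<Longrightarrow> finite (C n - D) \<Longrightarrow> D \<in> \<A>"
    by metis
  obtain G where G: "\<And>n. finite (G n)" "\<And>x. finite {n. x \<in> C n - G n}"
    using point_finite_after_finite_removal[of C] C(2) by blast
  show thesis
  proof
    show "C n - G n \<in> \<A>" for n
    proof (rule C(3))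
      show "finite (C n - (C n - G n))"
        using G(1)[of n] by (rule rev_finite_subset) blast
    qed blast
    show "C n - G n \<subseteq> A n" for n
      using C(1) by blast
  qed (rule G(2))
qed

lemma not_I_pre_wins_G_less_2_if_alpha4:
  assumes \<A>: "almost_Gamma_like \<A>" and \<B>: "Gamma_like \<B>" and \<alpha>: "alpha4 \<A> \<B>"
  shows "\<not> I_pre_wins_G_less_2 \<A> \<B>"
  unfolding I_pre_wins_G_less_2_def no_predetermined_winning_strategy_iff
proof (intro allI impI)
  fix A :: "nat \<Rightarrow> 'a set"
  assume "\<forall>n. A n \<in> \<A>"
  then obtain D where D: "\<And>n. D n \<in> \<A>" "\<And>n. D n \<subseteq> A n" "\<And>x. finite {n. x \<in> D n}"
    using almost_Gamma_like_point_finite_refinement[OF \<A>, of A] by blast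
  from \<alpha> D(1) obtain B where B: "B \<in> \<B>" and inf: "infinite {n. D n \<inter> B \<noteq> {}}"
    unfolding alpha4_def by blast
  let ?N = "{n. D n \<inter> B \<noteq> {}}"
  have "\<forall>n\<in>?N. \<exists>y. y \<in> D n \<inter> B"
    by blast
  then obtain x where x: "\<And>n. n \<in> ?N \<Longrightarrow> x n \<in> D n \<inter> B"
    unfolding bchoice_iff by blast
  define F where "F n = (if n \<in> ?N then {x n} else {})" for n
  have UF: "(\<Union>n. F n) = x ` ?N"
    by (auto simp: F_def)
  have "infinite (x ` ?N)"
  proof
    assume "finite (x ` ?N)"
    then obtain m where "infinite {n \<in> ?N. x n = x m}"
      using pigeonhole_infinite[OF inf] by blast
    moreover have "{n \<in> ?N. x n = x m} \<subseteq> {n. x m \<in> D n}"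
      using x by force
    ultimately show False
      using D(3) finite_subset by blast
  qed
  moreover have "x ` ?N \<subseteq> B"
    using x by blast
  ultimately have "x ` ?N \<in> \<B>"
    using \<B> B unfolding Gamma_like_def by blast
  moreover have "F n \<subseteq> A n \<and> finite (F n) \<and> card (F n) < 2" for n
    using x[of n] D(2)[of n] by (auto simp: F_def)
  ultimately show "\<exists>F. (\<forall>n. F n \<subseteq> A n \<and> finite (F n) \<and> card (F n) < 2) \<and> (\<Union>n. F n) \<in> \<B>"
    using UF by metis
qed

theorem theorem11:
  fixes \<A> \<B> :: "'a set set"
  assumes "almost_Gamma_like \<A>"
    and "Gamma_like \<B>"
  shows "(alpha4 \<A> \<B> \<longleftrightarrow> \<not> I_pre_wins_G_less_2 \<A> \<B>) \<and>
         (\<not> I_pre_wins_G_less_2 \<A> \<B> \<longleftrightarrow> \<not> I_pre_wins_G_fin \<A> \<B>)"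
proof -
  have "I_pre_wins_G_fin \<A> \<B> \<Longrightarrow> I_pre_wins_G_less_2 \<A> \<B>"
    unfolding I_pre_wins_G_fin_def I_pre_wins_G_less_2_def by (erule I_pre_wins_mono) simp
  with assms show ?thesis
    using not_I_pre_wins_G_less_2_if_alpha4 alpha4_if_not_I_pre_wins_G_fin by blast
qed

end
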